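(* Let $\beta>1$ and suppose $$\sum_{n\ge 1}2^{-n}N_n^{\beta}<+\infty .$$ Then, almost surely, the measure $\mu_{\Lambda}=\sum_{\lambda\in \Lambda(\omega)}(1-|\lambda|^2)\delta_{\lambda}$ is a Carleson measure for the Hardy space $H^2$.
   Context: $\mathbb{D}$ is the open unit disk and $\mathbb{T}$ the unit circle. Random sequence: $(\rho_n)\subset[0,1)$ is a fixed (deterministic) sequence of radii, $(\theta_n(\omega))$ is a sequence of independent random variables, all uniformly distributed on $[0,2\pi]$, and $\Lambda=\Lambda(\omega)=\{\lambda_n\}$ is the set of points $\lambda_n=\rho_n e^{i\theta_n(\omega)}$. For $n=0,1,2,\ldots$, $N_n=\#\{\lambda\in\Lambda(\omega): 1-2^{-n}\le|\lambda|<1-2^{-n-1}\}$; almost surely this depends only on the radii. It is assumed that every $N_n$ ($n\ge 0$) is finite. $\delta_\lambda$ denotes the unit point mass at $\lambda$. A positive Borel measure $\mu$ on $\mathbb{D}$ is a Carleson measure for $H^2$ if there is a constant $C$ such that $\mu(S_I)\le C|I|$ for every interval (arc) $I\subset\mathbb{T}$, where $|I|$ is the normalized Lebesgue measure of $I$ and $S_I=\{re^{it}\in\mathbb{D}: e^{it}\in I,\ 1-|I|\le r<1\}$. *)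

theory Defs
  imports "HOL-Probability.Probability"
begin

definition disc_borel :: "complex measure" where
  "disc_borel = restrict_space borel (ball 0 1)"

definition circle_measure :: "complex measure" where
  "circle_measure = distr (uniform_measure lborel {0..2 * pi}) borel cis"

(* An arc is the image of a real interval of any kind (open, closed, half-open, degenerate,
   of any length), so the full circle is included. *)
definition circle_interval :: "complex set \<Rightarrow> bool" where
  "circle_interval I \<longleftrightarrow> (\<exists>J :: real set. is_interval J \<and> I = cis ` J)"

abbreviation circle_length :: "complex set \<Rightarrow> real" where
  "circle_length I \<equiv> measure circle_measure I"

(* The radius is automatically nonnegative, because circle_length I is at most 1. *)
definition carleson_box :: "complex set \<Rightarrow> complex set" where
  "carleson_box I =
     {complex_of_real r * cis t | r t. cis t \<in> I \<and> 1 - circle_length I \<le> r \<and> r < 1}"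

definition carleson_measure_H2 :: "complex measure \<Rightarrow> bool" where
  "carleson_measure_H2 \<mu> \<longleftrightarrow>
     sets \<mu> = sets disc_borel \<and>
     (\<exists>C :: real. C \<ge> 0 \<and>
        (\<forall>I. circle_interval I \<longrightarrow> emeasure \<mu> (carleson_box I) \<le> ennreal (C * circle_length I)))"

(* The sum of weighted point masses, indexed by the points of the set \<Lambda> without multiplicity;
   emeasure_point_mass_sum gives its values. *)
definition point_mass_sum :: "complex set \<Rightarrow> complex measure" where
  "point_mass_sum \<Lambda> =
     distr (point_measure \<Lambda> (\<lambda>z. ennreal (1 - (cmod z)\<^sup>2))) disc_borel (\<lambda>z. z)"

definition random_points :: "(nat \<Rightarrow> real) \<Rightarrow> (nat \<Rightarrow> 'a \<Rightarrow> real) \<Rightarrow> 'a \<Rightarrow> complex set" where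
  "random_points \<rho> \<theta> \<omega> = range (\<lambda>n. complex_of_real (\<rho> n) * cis (\<theta> n \<omega>))"

definition dyadic_points :: "complex set \<Rightarrow> nat \<Rightarrow> complex set" where
  "dyadic_points \<Lambda> n = {z \<in> \<Lambda>. 1 - 1 / 2 ^ n \<le> cmod z \<and> cmod z < 1 - 1 / 2 ^ (n + 1)}"

lemma emeasure_point_mass_sum:
  assumes "\<Lambda> \<subseteq> ball 0 1" and "A \<in> sets disc_borel"
  shows "emeasure (point_mass_sum \<Lambda>) A =
    (\<integral>\<^sup>+ z. ennreal (1 - (cmod z)\<^sup>2) * emeasure (return disc_borel z) A \<partial>count_space \<Lambda>)"
proof -
  have A: "A \<subseteq> ball 0 1"
    using assms(2) sets.sets_into_space[of A disc_borel]
    by (simp add: disc_borel_def space_restrict_space)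
  have "emeasure (point_mass_sum \<Lambda>) A =
      emeasure (point_measure \<Lambda> (\<lambda>z. ennreal (1 - (cmod z)\<^sup>2))) (A \<inter> \<Lambda>)"
    unfolding point_mass_sum_def
    by (subst emeasure_distr)
      (use assms in \<open>auto simp: disc_borel_def space_restrict_space space_point_measure
        measurable_point_measure_eq1\<close>)
  also have "\<dots> = (\<integral>\<^sup>+ z. ennreal (1 - (cmod z)\<^sup>2) * indicator (A \<inter> \<Lambda>) z \<partial>count_space \<Lambda>)"
    unfolding point_measure_def by (subst emeasure_density) auto
  also have "\<dots> = (\<integral>\<^sup>+ z. ennreal (1 - (cmod z)\<^sup>2) * emeasure (return disc_borel z) A \<partial>count_space \<Lambda>)"
    by (rule nn_integral_cong) (use assms(2) in \<open>auto simp: indicator_def\<close>)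
  finally show ?thesis .
qed

lemma circle_interval_sigma_compact:
  assumes "circle_interval I"
  obtains F :: "nat \<Rightarrow> complex set" where "\<And>n. compact (F n)" "I = (\<Union>n. F n)"
proof -
  obtain J :: "real set" where J: "is_interval J" "I = cis ` J"
    using assms by (auto simp: circle_interval_def)
  have "\<exists>a b. J - interior J \<subseteq> {a, b}"
  proof -
    have "J - interior J \<subseteq> {Inf J, Sup J}"
    proof
      fix x assume x: "x \<in> J - interior J"
      show "x \<in> {Inf J, Sup J}"
      proof (cases "\<exists>y\<in>J. y < x")
        case True
        then obtain y where y: "y \<in> J" "y < x" by blast
        have "z \<le> x" if z: "z \<in> J" for z
        proof (rule ccontr)
          assume "\<not> z \<le> x"
          then have "x \<in> {y<..<z}" using y by simp
          moreover have "{y<..<z} \<subseteq> J"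
          proof
            fix u assume "u \<in> {y<..<z}"
            then have "y \<le> u" "u \<le> z" by auto
            then show "u \<in> J" using J(1) y(1) z unfolding is_interval_1 by blast
          qed
          ultimately have "x \<in> interior J"
            by (meson interiorI open_greaterThanLessThan)
          then show False using x by blast
        qed
        then show ?thesis using x cSup_eq_maximum[of x J] by auto
      next
        case False
        then show ?thesis using x cInf_eq_minimum[of x J] by force
      qed
    qed
    then show ?thesis by blast
  qed
  then obtain a b where ab: "J - interior J \<subseteq> {a, b}" by blast
  obtain C :: "nat \<Rightarrow> real set" where C: "\<And>n. compact (C n)" "\<And>n. C n \<subseteq> interior J"
      "(\<Union>n. C n) = interior J"
    using open_Union_compact_subsets[of "interior J"] open_interior by metis
  define K where "K n = C n \<union> (J - interior J)" for n
  have fin: "finite (J - interior J)"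
    using ab finite_subset by blast
  have "compact (cis ` K n)" for n
    unfolding K_def
    by (intro compact_continuous_image compact_Un C finite_imp_compact fin continuous_intros)
  moreover have "(\<Union>n. K n) = J"
    using C(3) interior_subset[of J] by (auto simp: K_def)
  then have "I = (\<Union>n. cis ` K n)"
    unfolding J(2) by blast
  ultimately show ?thesis
    using that[of "\<lambda>n. cis ` K n"] by blast
qed

lemma circle_interval_borel: "circle_interval I \<Longrightarrow> I \<in> sets borel"
  by (erule circle_interval_sigma_compact) (auto intro: borel_compact)

lemma prob_space_circle_measure: "prob_space circle_measure"
proof -
  have "cis \<in> borel_measurable borel"
    by (intro borel_measurable_continuous_onI continuous_intros)
  then have "cis \<in> borel_measurable (uniform_measure lborel {0..2 * pi})"
    by (simp cong: measurable_cong_sets)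
  then show ?thesis
    unfolding circle_measure_def
    by (intro prob_space.prob_space_distr prob_space_uniform_measure) auto
qed

lemma carleson_box_in_sets:
  assumes "circle_interval I"
  shows "carleson_box I \<in> sets disc_borel"
proof -
  obtain F :: "nat \<Rightarrow> complex set" where F: "\<And>n. compact (F n)" "I = (\<Union>n. F n)"
    using circle_interval_sigma_compact[OF assms] by metis
  let ?l = "circle_length I"
  have l: "?l \<le> 1"
    using prob_space.prob_le_1[OF prob_space_circle_measure] .
  define G where "G n m = (\<lambda>p. complex_of_real (fst p) * snd p) `
      ({1 - ?l..1 - 1 / (real m + 1)} \<times> F n)" for n m
  have "compact (G n m)" for n m
    unfolding G_def
    by (intro compact_continuous_image compact_Times F continuous_intros compact_Icc)
  then have G: "G n m \<in> sets borel" for n m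
    using borel_compact by blast
  have circ: "\<exists>t. z = cis t" if "z \<in> F n" for z n
  proof -
    have "z \<in> I" using that F(2) by blast
    then show ?thesis using assms by (auto simp: circle_interval_def)
  qed
  have eq: "carleson_box I = (\<Union>n. \<Union>m. G n m)"
  proof (intro equalityI subsetI)
    fix z assume "z \<in> carleson_box I"
    then obtain r t where z: "z = complex_of_real r * cis t" "cis t \<in> I" "1 - ?l \<le> r" "r < 1"
      by (auto simp: carleson_box_def)
    obtain m where "inverse (real (Suc m)) < 1 - r"
      using reals_Archimedean[of "1 - r"] z(4) by auto
    then have "r \<le> 1 - 1 / (real m + 1)"
      by (simp add: inverse_eq_divide add.commute)
    moreover obtain n where "cis t \<in> F n" using z(2) F(2) by blast
    ultimately have "z \<in> G n m"
      unfolding G_def using z by (intro image_eqI[where x = "(r, cis t)"]) auto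
    then show "z \<in> (\<Union>n. \<Union>m. G n m)" by blast
  next
    fix z assume "z \<in> (\<Union>n. \<Union>m. G n m)"
    then obtain n m r w where z: "z = complex_of_real r * w" "w \<in> F n" "1 - ?l \<le> r"
        "r \<le> 1 - 1 / (real m + 1)"
      by (auto simp: G_def)
    have "(0::real) < 1 / (real m + 1)" by simp
    then have "r < 1" using z(4) by linarith
    moreover obtain t where "w = cis t" using circ z(2) by blast
    ultimately show "z \<in> carleson_box I"
      using z F(2) by (auto simp: carleson_box_def)
  qed
  have "carleson_box I \<in> sets borel"
    unfolding eq by (intro sets.countable_UN'' countableI_type G)
  moreover have "carleson_box I \<subseteq> ball 0 1"
    using l by (auto simp: carleson_box_def norm_mult dist_norm)
  ultimately show ?thesis
    by (simp add: disc_borel_def sets_restrict_space_iff)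
qed

end

theory Submission
  imports Defs
begin

text \<open>The finitely many points of modulus below \<open>1 / 2\<close> lie only in large boxes and do no harm; the
following concerns the points of modulus at least \<open>1 / 2\<close>.  The terms of the convergent series
are bounded, which gives $N_n \le B \, 2^{n / \beta}$ for $n \ge 1$, so the total mass
$\sum (1 - |\lambda|)$ of the points with $|\lambda| \ge 1 - 2^{-m}$ is at most $C q^m$ with $q = 2^{1/\beta - 1} < 1$ (\<open>tail_mass_geometric\<close>).  This is where \<open>\<beta> > 1\<close>
is used.  The counts here are counts of radii, hence deterministic; they agree with the random
$N_n$ for $n \ge 1$ because the directions are almost surely distinct (\<open>AE_inj_uniform_circle\<close>,
\<open>bij_betw_level_dyadic_points\<close>).

Fix one of the $2^m$ dyadic arcs of length $2^{-m}$.  The mass over it of the points with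
$|\lambda| \ge 1 - 2^{-m}$, divided by $2^{-m}$, is a sum of independent variables with values in
$[0, 1]$ whose expectation is at most $C q^m$.  Such a sum of exponentially small expectation
exceeds a constant \<open>r\<close> with probability at most a constant times $q^{m r}$
(\<open>prob_weighted_hits_ge_le\<close>).  For \<open>r\<close> so large that $q^r < 1/4$, summing over the arcs and
over \<open>m\<close> leaves a convergent series, and the Borel-Cantelli lemma bounds the normalised masses
of all dyadic arcs simultaneously, almost surely (\<open>AE_weighted_hits_bounded\<close>).

The rest is deterministic.  An arc of length \<open>l\<close> is covered by three neighbouring dyadic arcs of
length comparable to \<open>l\<close> (\<open>arc_subset_three_dyadic_arcs\<close>), so the bound for dyadic arcs gives
the bound for all Carleson boxes (\<open>carleson_measure_H2_point_mass_sumI\<close>).\<close>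

section \<open>Normalised length of arcs\<close>

lemma circle_length_eq_lborel:
  assumes "S \<in> sets borel"
  shows "circle_length S = measure lborel ({0..2 * pi} \<inter> cis -` S) / (2 * pi)"
proof -
  have cis [measurable]: "cis \<in> borel_measurable borel"
    by (intro borel_measurable_continuous_onI continuous_intros)
  have V: "cis -` S \<in> sets borel"
    using measurable_sets[OF cis assms] by simp
  have "circle_length S = measure (uniform_measure lborel {0..2 * pi}) (cis -` S)"
    unfolding circle_measure_def using assms
    by (subst measure_distr) (auto simp: measurable_cong_sets[of "uniform_measure lborel _" borel])
  also have "\<dots> = measure lborel ({0..2 * pi} \<inter> cis -` S) / measure lborel {0..2 * pi}"
    by (rule measure_uniform_measure) (use V in auto)
  finally show ?thesis by simp
qed

lemma cis_shift: "cis (t + 2 * pi * of_int i) = cis t"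
  by (simp flip: cis_mult)

lemma closed_arc_borel: "cis ` {u..v} \<in> sets borel"
  by (intro borel_compact compact_continuous_image continuous_intros compact_Icc)

lemma circle_length_mono:
  assumes "A \<subseteq> B" "B \<in> sets borel"
  shows "circle_length A \<le> circle_length B"
proof -
  interpret prob_space circle_measure by (rule prob_space_circle_measure)
  show ?thesis
    using assms by (intro finite_measure_mono) (auto simp: circle_measure_def)
qed

lemma Icc_fmeasurable_lborel: "{a..b::real} \<in> fmeasurable lborel"
  by (rule fmeasurableI) (auto simp: emeasure_lborel_Icc_eq)

text \<open>The bound holds for every position of the arc.  After a shift by a multiple of $2 \pi$ the arc starts
in $[0, 2 \pi)$, and if it passes $2 \pi$, then the part beyond reappears at the left end of
$[0, 2 \pi]$, disjoint from the first part because the arc makes at most one turn.\<close>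
lemma circle_length_closed_arc_ge:
  assumes "u \<le> v" "v \<le> u + 2 * pi"
  shows "(v - u) / (2 * pi) \<le> circle_length (cis ` {u..v})"
proof -
  define i where "i = \<lfloor>u / (2 * pi)\<rfloor>"
  define a where "a = u - 2 * pi * of_int i"
  define b where "b = v - 2 * pi * of_int i"
  have a: "0 \<le> a" "a < 2 * pi"
    using floor_divide_lower[of "2 * pi" u] floor_divide_upper[of "2 * pi" u]
    by (auto simp: a_def i_def algebra_simps)
  have b: "a \<le> b" "b \<le> a + 2 * pi"
    using assms by (auto simp: a_def b_def)
  have shift: "cis t \<in> cis ` {u..v}" if "a \<le> t + 2 * pi * of_int n" "t + 2 * pi * of_int n \<le> b" for t and n :: int
  proof
    show "cis t = cis (t + 2 * pi * of_int (n + i))" by (rule cis_shift[symmetric])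
    show "t + 2 * pi * of_int (n + i) \<in> {u..v}"
      using that by (auto simp: a_def b_def algebra_simps)
  qed
  define V where "V = {0..2 * pi} \<inter> cis -` (cis ` {u..v})"
  have cis: "cis \<in> borel_measurable borel"
    by (intro borel_measurable_continuous_onI continuous_intros)
  have "cis -` (cis ` {u..v}) \<in> sets borel"
    using measurable_sets[OF cis closed_arc_borel[of u v]] by simp
  then have V: "V \<in> sets borel" unfolding V_def by auto
  have Vfin: "V \<in> fmeasurable lborel"
    by (rule fmeasurableI2[OF Icc_fmeasurable_lborel[of 0 "2 * pi"]]) (use V in \<open>auto simp: V_def\<close>)
  have 1: "{a..min b (2 * pi)} \<subseteq> V"
    using a shift[of _ 0] by (auto simp: V_def)
  have 2: "{0..<b - 2 * pi} \<subseteq> V"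
    using a b shift[of _ 1] by (auto simp: V_def)
  have "b - a \<le> measure lborel V"
  proof (cases "b \<le> 2 * pi")
    case True
    then show ?thesis
      using measure_mono_fmeasurable[OF 1 _ Vfin] b by simp
  next
    case False
    have "measure lborel ({a..min b (2 * pi)} \<union> {0..<b - 2 * pi}) \<le> measure lborel V"
      using 1 2 by (intro measure_mono_fmeasurable Vfin) auto
    also have "measure lborel ({a..min b (2 * pi)} \<union> {0..<b - 2 * pi}) =
        measure lborel {a..min b (2 * pi)} + measure lborel {0..<b - 2 * pi}"
      by (rule measure_Union) (use a b False in auto)
    finally show ?thesis using False a b by simp
  qed
  then show ?thesis
    using circle_length_eq_lborel[OF closed_arc_borel[of u v]]
    by (simp add: a_def b_def V_def divide_right_mono)
qed

text \<open>Apart from the interval itself, only the two endpoints 0 and $2 \pi$, which parametrise the same point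
of the circle, can be mapped into the arc.\<close>
lemma circle_length_closed_arc_le:
  assumes "0 \<le> u" "u \<le> v" "v \<le> 2 * pi"
  shows "circle_length (cis ` {u..v}) \<le> (v - u) / (2 * pi)"
proof -
  have sub: "{0..2 * pi} \<inter> cis -` (cis ` {u..v}) \<subseteq> {u..v} \<union> {0, 2 * pi}"
  proof
    fix t assume "t \<in> {0..2 * pi} \<inter> cis -` (cis ` {u..v})"
    then obtain s where s: "0 \<le> t" "t \<le> 2 * pi" "u \<le> s" "s \<le> v" "cis t = cis s" by auto
    obtain n :: int where n: "t = s + 2 * pi * n"
      using s(5) sin_cos_eq_iff[of t s] by (auto simp: cis.ctr)
    show "t \<in> {u..v} \<union> {0, 2 * pi}"
    proof (cases "n = 0")
      case True
      then show ?thesis using s n by auto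
    next
      case False
      then consider "n \<ge> 1" | "n \<le> -1" by linarith
      then show ?thesis
      proof cases
        case 1
        then have "real_of_int n \<ge> 1" by simp
        then have "2 * pi * 1 \<le> 2 * pi * real_of_int n" by (intro mult_left_mono) auto
        then have "t = 2 * pi" using n s assms by linarith
        then show ?thesis by simp
      next
        case 2
        then have "real_of_int n \<le> -1" by simp
        then have "2 * pi * real_of_int n \<le> 2 * pi * (-1)" by (intro mult_left_mono) auto
        then have "t = 0" using n s assms by linarith
        then show ?thesis by simp
      qed
    qed
  qed
  have "measure lborel ({0..2 * pi} \<inter> cis -` (cis ` {u..v})) \<le> measure lborel ({u..v} \<union> {0, 2 * pi})"
  proof (rule measure_mono_fmeasurable[OF sub])
    have cis: "cis \<in> borel_measurable borel"
      by (intro borel_measurable_continuous_onI continuous_intros)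
    show "{0..2 * pi} \<inter> cis -` (cis ` {u..v}) \<in> sets lborel"
      using measurable_sets[OF cis closed_arc_borel[of u v]] by auto
    show "{u..v} \<union> {0, 2 * pi} \<in> fmeasurable lborel"
      by (rule fmeasurableI2[OF Icc_fmeasurable_lborel[of 0 "2 * pi"]]) (use assms in auto)
  qed
  also have "\<dots> \<le> measure lborel {u..v} + measure lborel {0, 2 * pi}"
    by (rule measure_Un_le) auto
  also have "measure lborel {0, 2 * pi} = 0"
    by (simp add: measure_def emeasure_lborel_countable)
  finally show ?thesis
    using circle_length_eq_lborel[OF closed_arc_borel[of u v]] assms
    by (simp add: divide_right_mono)
qed

section \<open>Concentration of the mass over many small sets\<close>

text \<open>An exponential-moment bound of Chernoff type, stated for $x = e^s$.  Convexity of \<open>exp\<close> gives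
$e^{s a} \le 1 + a (e^s - 1)$ for $0 \le a \le 1$.  Hence a single summand has exponential moment at
most $1 + (x - 1) p a \le \exp((x - 1) p a)$, and independence multiplies these bounds.\<close>
lemma (in prob_space) prob_weighted_hits_ge_le:
  fixes a :: "'i \<Rightarrow> real"
  assumes indep: "indep_vars (\<lambda>_. N) X F" and fin: "finite F" and D: "D \<in> sets N"
    and a: "\<And>k. k \<in> F \<Longrightarrow> 0 \<le> a k \<and> a k \<le> 1"
    and p: "\<And>k. k \<in> F \<Longrightarrow> prob (X k -` D \<inter> space M) \<le> p" "0 \<le> p"
    and x: "1 < x"
  shows "prob {\<omega> \<in> space M. A \<le> (\<Sum>k\<in>F. a k * indicator D (X k \<omega>))}
    \<le> x powr (- A) * exp ((x - 1) * p * (\<Sum>k\<in>F. a k))"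
proof -
  have rv [measurable]: "X k \<in> measurable M N" if "k \<in> F" for k
    using indep that by (auto simp: indep_vars_def)
  note D [measurable]
  define s where "s = ln x"
  have s: "s > 0" "exp s = x" using x by (auto simp: s_def)
  have single: "(\<integral>\<^sup>+\<omega>. ennreal (exp (s * (a k * indicator D (X k \<omega>)))) \<partial>M)
      \<le> ennreal (exp ((x - 1) * p * a k))" if k: "k \<in> F" for k
  proof -
    have conv: "exp (s * a k) \<le> 1 + a k * (x - 1)"
    proof -
      have "exp ((1 - a k) *\<^sub>R 0 + a k *\<^sub>R s) \<le> (1 - a k) * exp 0 + a k * exp s"
        by (rule convex_onD[OF exp_convex]) (use a[OF k] in auto)
      then show ?thesis by (simp add: s algebra_simps)
    qed
    have "(\<integral>\<^sup>+\<omega>. ennreal (exp (s * (a k * indicator D (X k \<omega>)))) \<partial>M)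
        \<le> (\<integral>\<^sup>+\<omega>. 1 + ennreal (a k * (x - 1)) * indicator (X k -` D \<inter> space M) \<omega> \<partial>M)"
    proof (rule nn_integral_mono)
      fix \<omega> assume w: "\<omega> \<in> space M"
      show "ennreal (exp (s * (a k * indicator D (X k \<omega>))))
        \<le> 1 + ennreal (a k * (x - 1)) * indicator (X k -` D \<inter> space M) \<omega>"
      proof (cases "X k \<omega> \<in> D")
        case True
        have "ennreal (exp (s * a k)) \<le> ennreal (1 + a k * (x - 1))"
          by (intro ennreal_leI conv)
        then show ?thesis using True w a[OF k] x by (simp add: ennreal_plus)
      qed simp
    qed
    also have "\<dots> = 1 + ennreal (a k * (x - 1)) * emeasure M (X k -` D \<inter> space M)"
      using k by (subst nn_integral_add) (auto simp: nn_integral_cmult emeasure_space_1)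
    also have "\<dots> = ennreal (1 + a k * (x - 1) * prob (X k -` D \<inter> space M))"
      using a[OF k] x by (simp add: emeasure_eq_measure ennreal_mult'' ennreal_plus)
    also have "\<dots> \<le> ennreal (1 + (x - 1) * p * a k)"
    proof (intro ennreal_leI add_left_mono)
      have "a k * (x - 1) * prob (X k -` D \<inter> space M) \<le> a k * (x - 1) * p"
        using a[OF k] x p(1)[OF k] by (intro mult_left_mono) auto
      then show "a k * (x - 1) * prob (X k -` D \<inter> space M) \<le> (x - 1) * p * a k"
        by (simp add: mult_ac)
    qed
    also have "\<dots> \<le> ennreal (exp ((x - 1) * p * a k))"
      by (intro ennreal_leI) (rule exp_ge_add_one_self)
    finally show ?thesis .
  qed
  have [measurable]: "(\<lambda>\<omega>. \<Sum>k\<in>F. a k * indicator D (X k \<omega>)) \<in> borel_measurable M"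
    by (intro borel_measurable_sum borel_measurable_times borel_measurable_const
        measurable_compose[OF rv borel_measurable_indicator] D)
  have "emeasure M {\<omega> \<in> space M. A \<le> (\<Sum>k\<in>F. a k * indicator D (X k \<omega>))}
      \<le> ennreal (exp (- s * A)) *
        (\<integral>\<^sup>+\<omega>. ennreal (exp (s * (\<Sum>k\<in>F. a k * indicator D (X k \<omega>)))) * indicator (space M) \<omega> \<partial>M)"
    by (rule Chernoff_ineq_nn_integral_ge) (use s in auto)
  also have "(\<integral>\<^sup>+\<omega>. ennreal (exp (s * (\<Sum>k\<in>F. a k * indicator D (X k \<omega>)))) * indicator (space M) \<omega> \<partial>M)
     = (\<integral>\<^sup>+\<omega>. (\<Prod>k\<in>F. ennreal (exp (s * (a k * indicator D (X k \<omega>))))) \<partial>M)"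
  proof (rule nn_integral_cong)
    fix \<omega> assume "\<omega> \<in> space M"
    then have "ennreal (exp (s * (\<Sum>k\<in>F. Y k))) * indicator (space M) \<omega> = (\<Prod>k\<in>F. ennreal (exp (s * Y k)))"
      for Y by (simp add: sum_distrib_left exp_sum fin prod_ennreal)
    then show "ennreal (exp (s * (\<Sum>k\<in>F. a k * indicator D (X k \<omega>)))) * indicator (space M) \<omega>
      = (\<Prod>k\<in>F. ennreal (exp (s * (a k * indicator D (X k \<omega>)))))" .
  qed
  also have "\<dots> = (\<Prod>k\<in>F. \<integral>\<^sup>+\<omega>. ennreal (exp (s * (a k * indicator D (X k \<omega>)))) \<partial>M)"
    by (intro indep_vars_nn_integral fin indep_vars_compose2[OF indep]) auto
  also have "\<dots> \<le> (\<Prod>k\<in>F. ennreal (exp ((x - 1) * p * a k)))"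
    by (intro prod_mono_ennreal single)
  also have "\<dots> = ennreal (exp ((x - 1) * p * (\<Sum>k\<in>F. a k)))"
    by (simp add: prod_ennreal exp_sum fin sum_distrib_left)
  finally have "emeasure M {\<omega> \<in> space M. A \<le> (\<Sum>k\<in>F. a k * indicator D (X k \<omega>))}
     \<le> ennreal (exp (- s * A) * exp ((x - 1) * p * (\<Sum>k\<in>F. a k)))"
    by (simp add: ennreal_mult mult_left_mono)
  moreover have "exp (- s * A) = x powr (- A)"
    using x by (simp add: powr_def s_def mult.commute)
  ultimately show ?thesis
    by (simp add: emeasure_eq_measure)
qed


text \<open>The probabilistic heart of the proof.  Think of \<open>F m\<close> as the indices of points so close to the
boundary that they can lie in a Carleson box of size $2^{-m}$, of \<open>b k\<close> as the mass of the
\<open>k\<close>-th point, and of the sets \<open>D m j\<close> as $2^m$ arcs of equal length that cover the circle.  The normalised expected mass over one arc is at most $C q^m$, so the exponential moment may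
be taken with the growing base $x = q^{-m}$ at the price of only a constant factor $e^C$.  Exceeding
the level \<open>r\<close> then has probability at most $e^C q^{m r}$, which for large \<open>r\<close> beats the
number $2^m$ of arcs with a summable remainder, so that the Borel-Cantelli lemma applies.\<close>
lemma (in prob_space) AE_weighted_hits_bounded:
  fixes b :: "nat \<Rightarrow> real" and F :: "nat \<Rightarrow> nat set" and D :: "nat \<Rightarrow> nat \<Rightarrow> 'b set"
  assumes indep: "indep_vars (\<lambda>_. N) X UNIV"
    and D: "\<And>m j. D m j \<in> sets N"
    and p: "\<And>m j k. j < 2 ^ m \<Longrightarrow> prob (X k -` D m j \<inter> space M) \<le> 1 / 2 ^ m"
    and b: "\<And>m k. k \<in> F m \<Longrightarrow> 0 \<le> b k \<and> b k \<le> 1 / 2 ^ m"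
    and tail: "\<And>m K. (\<Sum>k\<in>F m \<inter> {..<K}. b k) \<le> C * q ^ m"
    and q: "0 < q" "q < 1"
  shows "AE \<omega> in M. \<exists>A\<ge>0. \<forall>m. \<forall>j<2^m. \<forall>K.
    (\<Sum>k\<in>F m \<inter> {..<K}. b k * indicator (D m j) (X k \<omega>)) \<le> A / 2 ^ m"
proof -
  have rv: "X k \<in> measurable M N" for k
    using indep by (auto simp: indep_vars_def)
  have C: "0 \<le> C" using tail[of 0 0] by simp
  \<comment> \<open>One factor $2^{-m}$ pays for the $2^m$ arcs of generation \<open>m\<close>, the other makes the sum over \<open>m\<close> finite.\<close>
  obtain r :: nat where r: "q ^ r < 1 / 4"
    using real_arch_pow_inv[of "1 / 4" q] q by auto
  define S where "S m j K \<omega> = (\<Sum>k\<in>F m \<inter> {..<K}. b k * indicator (D m j) (X k \<omega>))" for m j K \<omega>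
  define E where "E m j K = {\<omega> \<in> space M. real r \<le> 2 ^ m * S m j K \<omega>}" for m j K
  have S_meas [measurable]: "S m j K \<in> borel_measurable M" for m j K
    unfolding S_def
    by (intro borel_measurable_sum borel_measurable_times borel_measurable_const
        measurable_compose[OF rv borel_measurable_indicator] D)
  have E_sets: "E m j K \<in> sets M" for m j K
    unfolding E_def by measurable
  have E_prob: "prob (E m j K) \<le> exp C / 4 ^ m" if m: "m \<ge> 1" and j: "j < 2 ^ m" for m j K
  proof -
    let ?F = "F m \<inter> {..<K}" and ?x = "1 / q ^ m"
    have x: "1 < ?x" using q m by (simp add: power_less_one_iff)
    have sum: "0 \<le> (\<Sum>k\<in>?F. b k)" using b by (intro sum_nonneg) auto
    have "E m j K = {\<omega> \<in> space M. real r \<le> (\<Sum>k\<in>?F. (2 ^ m * b k) * indicator (D m j) (X k \<omega>))}"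
      unfolding E_def S_def by (simp only: sum_distrib_left mult.assoc)
    also have "prob \<dots> \<le> ?x powr (- real r) * exp ((?x - 1) * (1 / 2 ^ m) * (\<Sum>k\<in>?F. 2 ^ m * b k))"
    proof (rule prob_weighted_hits_ge_le[OF indep_vars_subset[OF indep]])
      show "0 \<le> 2 ^ m * b k \<and> 2 ^ m * b k \<le> 1" if "k \<in> ?F" for k
        using b[of k m] that by (auto simp: field_simps)
    qed (use D p[OF j] x in auto)
    also have "?x powr (- real r) = (q ^ r) ^ m"
      using q by (simp add: powr_minus powr_realpow power_one_over mult.commute flip: power_mult)
    also have "(?x - 1) * (1 / 2 ^ m) * (\<Sum>k\<in>?F. 2 ^ m * b k) = (?x - 1) * (\<Sum>k\<in>?F. b k)"
      by (simp flip: sum_distrib_left)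
    also have "(q ^ r) ^ m * exp ((?x - 1) * (\<Sum>k\<in>?F. b k)) \<le> (1 / 4) ^ m * exp C"
    proof (intro mult_mono power_mono)
      have "(?x - 1) * (\<Sum>k\<in>?F. b k) \<le> ?x * (C * q ^ m)"
        using x sum tail[of m K] q by (intro mult_mono) auto
      then show "exp ((?x - 1) * (\<Sum>k\<in>?F. b k)) \<le> exp C" using q by simp
    qed (use r q in auto)
    finally show ?thesis by (simp add: power_one_over)
  qed
  define G where "G m = (\<Union>j<2^m. \<Union>K. E m j K)" for m
  have G_sets: "G m \<in> sets M" for m
    unfolding G_def by (intro sets.finite_UN sets.countable_UN'' E_sets) auto
  have G_prob: "prob (G m) \<le> exp C * (1 / 2) ^ m" if m: "m \<ge> 1" for m
  proof -
    \<comment> \<open>The bound for the truncated sums is uniform in the truncation, and the events increase with it.\<close>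
    have U: "prob (\<Union>K. E m j K) \<le> exp C / 4 ^ m" if j: "j < 2 ^ m" for j
    proof (rule LIMSEQ_le_const2)
      show "(\<lambda>K. prob (E m j K)) \<longlonglongrightarrow> prob (\<Union>K. E m j K)"
      proof (rule finite_Lim_measure_incseq)
        have "S m j K \<omega> \<le> S m j K' \<omega>" if "K \<le> K'" for K K' \<omega>
          unfolding S_def using that b by (intro sum_mono2) (auto simp: indicator_def)
        then have "2 ^ m * S m j K \<omega> \<le> 2 ^ m * S m j K' \<omega>" if "K \<le> K'" for K K' \<omega>
          using that by simp
        then show "incseq (\<lambda>K. E m j K)"
          unfolding incseq_def E_def by (blast intro: order_trans)
      qed (use E_sets in auto)
    qed (use E_prob[OF m j] in auto)
    have "prob (G m) \<le> (\<Sum>j<2^m. prob (\<Union>K. E m j K))"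
      unfolding G_def by (intro measure_UNION_le sets.countable_UN'' E_sets) auto
    also have "\<dots> \<le> (\<Sum>j<(2::nat)^m. exp C / 4 ^ m)"
      by (intro sum_mono U) auto
    also have "\<dots> = exp C * (1 / 2) ^ m"
      by (simp add: power_one_over field_simps flip: power_mult_distrib)
    finally show ?thesis .
  qed
  have "AE \<omega> in M. eventually (\<lambda>m. \<omega> \<in> space M - G m) sequentially"
  proof (rule borel_cantelli_AE1)
    have "summable (\<lambda>m. exp C * (1 / 2 :: real) ^ m)"
      by (intro summable_mult summable_geometric) auto
    then show "summable (\<lambda>m. prob (G m))"
      by (rule summable_comparison_test'[where N = 1]) (use G_prob in auto)
  qed (use G_sets in \<open>auto simp: emeasure_eq_measure\<close>)
  then show ?thesis
  proof (rule AE_mp, intro AE_I2 impI)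
    fix \<omega> assume "\<omega> \<in> space M" "eventually (\<lambda>m. \<omega> \<in> space M - G m) sequentially"
    then obtain m0 where m0: "\<And>m. m \<ge> m0 \<Longrightarrow> \<omega> \<in> space M - G m"
      by (auto simp: eventually_sequentially)
    \<comment> \<open>The generations below \<open>m0\<close> are covered by the bound \<open>C\<close> on the total mass.\<close>
    define A where "A = max (real r) (2 ^ m0 * C)"
    have "S m j K \<omega> \<le> A / 2 ^ m" if j: "j < 2 ^ m" for m j K
    proof (cases "m \<ge> m0")
      case True
      then have "\<omega> \<notin> E m j K" "\<omega> \<in> space M" using m0[OF True] j by (auto simp: G_def)
      then have "2 ^ m * S m j K \<omega> \<le> A" by (auto simp: E_def A_def)
      then show ?thesis by (simp add: field_simps)
    next
      case False
      have "S m j K \<omega> \<le> (\<Sum>k\<in>F m \<inter> {..<K}. b k)"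
        unfolding S_def using b by (intro sum_mono) (auto simp: indicator_def)
      also have "\<dots> \<le> C * q ^ m" by (rule tail)
      also have "\<dots> \<le> C * 1" using C q by (intro mult_left_mono power_le_one) auto
      finally have "2 ^ m * S m j K \<omega> \<le> 2 ^ m * C" by simp
      also have "\<dots> \<le> 2 ^ m0 * C"
        using False C by (intro mult_right_mono power_increasing) auto
      also have "\<dots> \<le> A" by (simp add: A_def)
      finally show ?thesis by (simp add: field_simps)
    qed
    moreover have "A \<ge> 0" by (simp add: A_def)
    ultimately show "\<exists>A\<ge>0. \<forall>m. \<forall>j<2^m. \<forall>K.
      (\<Sum>k\<in>F m \<inter> {..<K}. b k * indicator (D m j) (X k \<omega>)) \<le> A / 2 ^ m"
      unfolding S_def by blast
  qed
qed

section \<open>Dyadic arcs\<close>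

text \<open>The indices \<open>j\<close> range over all integers, with period $2^m$ in effect, so that the neighbours of an
arc are simply those with indices \<open>j - 1\<close> and \<open>j + 1\<close>, even across the point 1.\<close>
definition dyadic_arc :: "nat \<Rightarrow> int \<Rightarrow> complex set" where
  "dyadic_arc m j = cis ` {2 * pi * of_int j / 2 ^ m .. 2 * pi * of_int (j + 1) / 2 ^ m}"

lemma dyadic_arc_borel: "dyadic_arc m j \<in> sets borel"
  unfolding dyadic_arc_def by (rule closed_arc_borel)

lemma cis_in_dyadic_arcI:
  assumes "of_int j \<le> 2 ^ m * t / (2 * pi)" "2 ^ m * t / (2 * pi) \<le> of_int j + 1"
  shows "cis t \<in> dyadic_arc m j"
  unfolding dyadic_arc_def using assms by (intro imageI) (auto simp: field_simps)

lemma dyadic_arc_mod: "dyadic_arc m (j mod 2 ^ m) = dyadic_arc m j"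
proof -
  define n where "n = j div 2 ^ m"
  have j: "j mod 2 ^ m = j - n * 2 ^ m" by (simp add: n_def minus_div_mult_eq_mod)
  have eq: "{2 * pi * of_int j / 2 ^ m .. 2 * pi * of_int (j + 1) / 2 ^ m} =
      (\<lambda>t. t + 2 * pi * of_int n) `
        {2 * pi * of_int (j mod 2 ^ m) / 2 ^ m .. 2 * pi * of_int (j mod 2 ^ m + 1) / 2 ^ m}"
    unfolding image_add_atLeastAtMost' by (intro arg_cong2[where f = atLeastAtMost]) (simp_all add: j field_simps)
  show ?thesis
    unfolding dyadic_arc_def eq image_image cis_shift ..
qed

lemma cis_in_some_dyadic_arc: "\<exists>j<2 ^ m. cis t \<in> dyadic_arc m (int j)"
proof -
  define i where "i = \<lfloor>2 ^ m * t / (2 * pi)\<rfloor>"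
  have "cis t \<in> dyadic_arc m i"
    unfolding i_def by (rule cis_in_dyadic_arcI) linarith+
  then have "cis t \<in> dyadic_arc m (int (nat (i mod 2 ^ m)))"
    by (simp add: dyadic_arc_mod)
  moreover have "nat (i mod 2 ^ m) < 2 ^ m"
    by (simp add: nat_less_iff)
  ultimately show ?thesis by blast
qed

lemma circle_length_dyadic_arc_le:
  assumes "j < 2 ^ m"
  shows "circle_length (dyadic_arc m (int j)) \<le> 1 / 2 ^ m"
proof -
  have "real (j + 1) \<le> real (2 ^ m)" using assms by (intro of_nat_mono) simp
  then have "2 * pi * (real j + 1) \<le> 2 * pi * 2 ^ m" by (intro mult_left_mono) auto
  then have "circle_length (dyadic_arc m (int j)) \<le>
      (2 * pi * of_int (int j + 1) / 2 ^ m - 2 * pi * of_int (int j) / 2 ^ m) / (2 * pi)"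
    unfolding dyadic_arc_def
    by (intro circle_length_closed_arc_le) (auto simp: field_simps)
  also have "\<dots> = 1 / 2 ^ m" by (simp add: field_simps)
  finally show ?thesis .
qed

text \<open>For \<open>m = 0\<close> a single dyadic arc is the whole circle.  For \<open>m \<ge> 1\<close> the arc is at most half of
the circle, and two of its parameters differ by at most $2 \pi / 2^m$, because parameters at distance
$d \le 2 \pi$ enclose an arc of normalised length at least $d / (2 \pi)$.  A cell of width $2 \pi / 2^m$
containing one parameter, together with its two neighbours, thus contains all of them.\<close>
lemma arc_subset_three_dyadic_arcs:
  assumes I: "circle_interval I" and le: "circle_length I \<le> 1 / 2 ^ m"
  shows "\<exists>j. I \<subseteq> dyadic_arc m (j - 1) \<union> dyadic_arc m j \<union> dyadic_arc m (j + 1)"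
proof (cases "m = 0")
  case True
  have "I \<subseteq> dyadic_arc m 0"
    using cis_in_some_dyadic_arc[of m] I by (auto simp: True circle_interval_def)
  then show ?thesis by blast
next
  case False
  then have "2 ^ 1 \<le> (2::real) ^ m" by (intro power_increasing) auto
  then have half: "1 / 2 ^ m \<le> 1 / (2::real)" by (simp add: field_simps)
  obtain J where J: "is_interval J" "I = cis ` J"
    using I by (auto simp: circle_interval_def)
  have width: "2 ^ m * (v - u) / (2 * pi) \<le> 1" if uv: "u \<in> J" "v \<in> J" "u \<le> v" for u v
  proof -
    define w where "w = min v (u + 2 * pi)"
    have "{u..w} \<subseteq> J"
      using J(1) uv(1,2) unfolding is_interval_1 w_def by (meson atLeastAtMost_iff min.boundedE subsetI)
    then have "circle_length (cis ` {u..w}) \<le> circle_length I"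
      using J(2) by (intro circle_length_mono[OF _ circle_interval_borel[OF I]]) blast
    moreover have "(w - u) / (2 * pi) \<le> circle_length (cis ` {u..w})"
      by (rule circle_length_closed_arc_ge) (use uv in \<open>auto simp: w_def\<close>)
    ultimately have *: "(w - u) / (2 * pi) \<le> 1 / 2 ^ m" using le by linarith
    have "w = v"
    proof (rule ccontr)
      assume "w \<noteq> v"
      then have "w = u + 2 * pi" by (auto simp: w_def min_def split: if_splits)
      then show False using * half by simp
    qed
    then show ?thesis using * by (simp add: field_simps)
  qed
  show ?thesis
  proof (cases "J = {}")
    case False
    then obtain u where u: "u \<in> J" by blast
    define x where "x t = 2 ^ m * t / (2 * pi)" for t :: real
    define j where "j = \<lfloor>x u\<rfloor>"
    have j: "of_int j \<le> x u" "x u \<le> of_int j + 1" unfolding j_def by linarith+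
    have "cis t \<in> dyadic_arc m (j - 1) \<union> dyadic_arc m j \<union> dyadic_arc m (j + 1)" if "t \<in> J" for t
    proof -
      have "x t \<le> x u + 1" "x u \<le> x t + 1"
      proof -
        have d: "x t - x u = 2 ^ m * (t - u) / (2 * pi)" "x u - x t = 2 ^ m * (u - t) / (2 * pi)"
          by (simp_all add: x_def right_diff_distrib diff_divide_distrib)
        have "x t - x u \<le> 1 \<and> x u - x t \<le> 1"
        proof (cases "u \<le> t")
          case True
          then have "0 \<le> x t - x u" unfolding d by simp
          then show ?thesis using width[OF u that True] d by linarith
        next
          case False
          then have "0 \<le> x u - x t" unfolding d by simp
          then show ?thesis using width[OF that u] False d by linarith
        qed
        then show "x t \<le> x u + 1" "x u \<le> x t + 1" by auto
      qed
      then consider "of_int (j - 1) \<le> x t" "x t \<le> of_int (j - 1) + 1"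
        | "of_int j \<le> x t" "x t \<le> of_int j + 1"
        | "of_int (j + 1) \<le> x t" "x t \<le> of_int (j + 1) + 1"
        using j by (cases "x t < of_int j"; cases "x t \<le> of_int j + 1") auto
      then show ?thesis
        by cases (auto simp: x_def intro: cis_in_dyadic_arcI)
    qed
    then show ?thesis unfolding J(2) by blast
  qed (simp add: J)
qed

section \<open>Almost sure distinctness of the directions\<close>

text \<open>If two directions coincide, then they lie in a common dyadic arc of every generation \<open>m\<close>.  By
independence this has probability at most $2^m \cdot 4^{-m}$.\<close>
lemma (in prob_space) AE_inj_uniform_circle:
  fixes \<theta> :: "nat \<Rightarrow> 'a \<Rightarrow> real"
  assumes indep: "indep_vars (\<lambda>_. borel) (\<lambda>k \<omega>. cis (\<theta> k \<omega>)) UNIV"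
    and p: "\<And>m j k. j < 2 ^ m \<Longrightarrow>
      prob ((\<lambda>\<omega>. cis (\<theta> k \<omega>)) -` dyadic_arc m (int j) \<inter> space M) \<le> 1 / 2 ^ m"
  shows "AE \<omega> in M. inj (\<lambda>k. cis (\<theta> k \<omega>))"
proof -
  have rv [measurable]: "(\<lambda>\<omega>. cis (\<theta> k \<omega>)) \<in> borel_measurable M" for k
    using indep by (auto simp: indep_vars_def)
  have "AE \<omega> in M. cis (\<theta> i \<omega>) \<noteq> cis (\<theta> k \<omega>)" if ik: "i \<noteq> k" for i k
  proof -
    define E where "E = {\<omega> \<in> space M. cis (\<theta> i \<omega>) = cis (\<theta> k \<omega>)}"
    have E [measurable]: "E \<in> sets M" unfolding E_def by measurable
    define H where "H l m j = (\<lambda>\<omega>. cis (\<theta> l \<omega>)) -` dyadic_arc m (int j) \<inter> space M" for l m j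
    have H: "H l m j \<in> sets M" for l m j
      unfolding H_def by (rule measurable_sets[OF rv dyadic_arc_borel])
    have bound: "prob E \<le> (1 / 2) ^ m" for m
    proof -
      have "E \<subseteq> (\<Union>j<2^m. H i m j \<inter> H k m j)"
      proof
        fix \<omega> assume w: "\<omega> \<in> E"
        obtain j where "j < 2 ^ m" "cis (\<theta> i \<omega>) \<in> dyadic_arc m (int j)"
          using cis_in_some_dyadic_arc by blast
        then show "\<omega> \<in> (\<Union>j<2^m. H i m j \<inter> H k m j)"
          using w by (auto simp: H_def E_def)
      qed
      then have "prob E \<le> prob (\<Union>j<2^m. H i m j \<inter> H k m j)"
        by (intro finite_measure_mono sets.finite_UN sets.Int H) auto
      also have "\<dots> \<le> (\<Sum>j<2^m. prob (H i m j \<inter> H k m j))"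
        by (intro measure_UNION_le sets.Int H) auto
      also have "\<dots> \<le> (\<Sum>j<(2::nat)^m. 1 / 4 ^ m)"
      proof (rule sum_mono)
        fix j :: nat assume "j \<in> {..<2^m}"
        then have j: "j < 2 ^ m" by simp
        have "prob (\<Inter>l\<in>{i, k}. (\<lambda>\<omega>. cis (\<theta> l \<omega>)) -` dyadic_arc m (int j) \<inter> space M)
          = (\<Prod>l\<in>{i, k}. prob ((\<lambda>\<omega>. cis (\<theta> l \<omega>)) -` dyadic_arc m (int j) \<inter> space M))"
          by (rule indep_varsD[OF indep]) (auto simp: dyadic_arc_borel)
        then have "prob (H i m j \<inter> H k m j) = prob (H i m j) * prob (H k m j)"
          using ik by (simp add: H_def)
        also have "\<dots> \<le> (1 / 2 ^ m) * (1 / 2 ^ m)"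
          using p[OF j] by (intro mult_mono) (auto simp: H_def)
        also have "\<dots> = 1 / (4::real) ^ m" by (simp flip: power_mult_distrib)
        finally show "prob (H i m j \<inter> H k m j) \<le> 1 / 4 ^ m" .
      qed
      also have "\<dots> = (1 / 2) ^ m"
        by (simp add: power_one_over field_simps flip: power_mult_distrib)
      finally show ?thesis .
    qed
    have "prob E \<le> 0"
      by (rule LIMSEQ_le_const[of "\<lambda>m. (1 / 2) ^ m"])
        (use bound in \<open>auto intro: LIMSEQ_power_zero\<close>)
    then have "E \<in> null_sets M"
      using E by (auto simp: null_sets_def emeasure_eq_measure measure_le_0_iff)
    then show ?thesis
      by (rule AE_I') (auto simp: E_def)
  qed
  then have "AE \<omega> in M. \<forall>i k. i \<noteq> k \<longrightarrow> cis (\<theta> i \<omega>) \<noteq> cis (\<theta> k \<omega>)"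
    by (simp add: AE_all_countable)
  then show ?thesis
    by eventually_elim (auto simp: inj_on_def)
qed

section \<open>Decay of the mass near the boundary\<close>

text \<open>This turns the growth condition on the numbers of points into the decay that the probabilistic
estimate needs: level \<open>n\<close> carries mass at most $2^{-n} B (2 q)^n = B q^n$, and these bounds form
a geometric series.\<close>
lemma tail_mass_geometric:
  fixes \<rho> :: "nat \<Rightarrow> real"
  assumes \<rho>: "\<And>k. \<rho> k < 1"
    and fin: "\<And>n. n \<ge> 1 \<Longrightarrow> finite {k. 1 - 1 / 2 ^ n \<le> \<rho> k \<and> \<rho> k < 1 - 1 / 2 ^ (n + 1)}"
    and card: "\<And>n. n \<ge> 1 \<Longrightarrow>
      real (card {k. 1 - 1 / 2 ^ n \<le> \<rho> k \<and> \<rho> k < 1 - 1 / 2 ^ (n + 1)}) \<le> B * (2 * q) ^ n"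
    and q: "0 < q" "q < 1"
  shows "(\<Sum>k\<in>{k. 1 / 2 \<le> \<rho> k \<and> 1 - 1 / 2 ^ m \<le> \<rho> k} \<inter> {..<K}. 1 - \<rho> k) \<le> B / (1 - q) * q ^ m"
proof -
  define L where "L n = {k. 1 - 1 / 2 ^ n \<le> \<rho> k \<and> \<rho> k < 1 - 1 / 2 ^ (n + 1)}" for n :: nat
  define S where "S = {k. 1 / 2 \<le> \<rho> k \<and> 1 - 1 / 2 ^ m \<le> \<rho> k} \<inter> {..<K}"
  have "0 \<le> B * (2 * q) ^ 1"
    using card[of 1] by (rule order_trans[rotated]) auto
  then have B: "0 \<le> B" using q by (simp add: zero_le_mult_iff)
  have "\<exists>n\<ge>1. n \<ge> m \<and> k \<in> L n" if k: "k \<in> S" for k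
  proof -
    obtain N :: nat where "(1 / 2) ^ N < 1 - \<rho> k"
      using real_arch_pow_inv[of "1 - \<rho> k" "1 / 2"] \<rho>[of k] by auto
    then have ex: "\<exists>n. \<rho> k < 1 - 1 / 2 ^ n" by (intro exI[of _ N]) (simp add: power_one_over)
    define n where "n = (LEAST n. \<rho> k < 1 - 1 / 2 ^ n)"
    have n: "\<rho> k < 1 - 1 / 2 ^ n" unfolding n_def using LeastI_ex[OF ex] .
    have below: "1 - 1 / 2 ^ i \<le> \<rho> k" if "i < n" for i
      using not_less_Least[of i "\<lambda>n. \<rho> k < 1 - 1 / 2 ^ n"] that by (auto simp: n_def)
    have above: "i < n" if "1 - 1 / 2 ^ i \<le> \<rho> k" for i
    proof (rule ccontr)
      assume "\<not> i < n"
      then have "(2::real) ^ n \<le> 2 ^ i" by (intro power_increasing) auto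
      then have "1 / (2::real) ^ i \<le> 1 / 2 ^ n" by (simp add: field_simps)
      then show False using n that by linarith
    qed
    have "1 < n" "m < n" using above[of 1] above[of m] k by (auto simp: S_def)
    then have "n - 1 \<ge> 1" "n - 1 \<ge> m" "k \<in> L (n - 1)"
      using below[of "n - 1"] n by (auto simp: L_def)
    then show ?thesis by blast
  qed
  then obtain lev where lev: "\<And>k. k \<in> S \<Longrightarrow> lev k \<ge> 1 \<and> lev k \<ge> m \<and> k \<in> L (lev k)" by metis
  have finS: "finite S" by (simp add: S_def)
  have "(\<Sum>k\<in>S. 1 - \<rho> k) = (\<Sum>n\<in>lev ` S. \<Sum>k\<in>{k \<in> S. lev k = n}. 1 - \<rho> k)"
    by (rule sum.image_gen[OF finS])
  also have "\<dots> \<le> (\<Sum>n\<in>lev ` S. B * q ^ n)"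
  proof (rule sum_mono)
    fix n assume n: "n \<in> lev ` S"
    then have n1: "n \<ge> 1" using lev by auto
    have "(\<Sum>k\<in>{k \<in> S. lev k = n}. 1 - \<rho> k) \<le> (\<Sum>k\<in>{k \<in> S. lev k = n}. 1 / 2 ^ n)"
      using lev by (intro sum_mono) (fastforce simp: L_def)
    also have "\<dots> = real (card {k \<in> S. lev k = n}) / 2 ^ n" by simp
    also have "\<dots> \<le> real (card (L n)) / 2 ^ n"
      using lev fin[OF n1]
      by (intro divide_right_mono of_nat_mono card_mono) (auto simp: L_def)
    also have "\<dots> \<le> (B * (2 * q) ^ n) / 2 ^ n"
      using card[OF n1] by (intro divide_right_mono) (auto simp: L_def)
    also have "\<dots> = B * q ^ n" by (simp add: power_mult_distrib)
    finally show "(\<Sum>k\<in>{k \<in> S. lev k = n}. 1 - \<rho> k) \<le> B * q ^ n" .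
  qed
  also have "\<dots> = B * (q ^ m * (\<Sum>n\<in>lev ` S. q ^ (n - m)))"
    using lev by (auto simp: sum_distrib_left intro!: sum.cong simp flip: power_add)
  also have "(\<Sum>n\<in>lev ` S. q ^ (n - m)) = (\<Sum>i\<in>(\<lambda>n. n - m) ` lev ` S. q ^ i)"
    by (subst sum.reindex) (use lev in \<open>auto simp: inj_on_def eq_diff_iff\<close>)
  also have "\<dots> \<le> (\<Sum>i. q ^ i)"
    using q finS by (intro sum_le_suminf summable_geometric) auto
  also have "\<dots> = 1 / (1 - q)" using q by (intro suminf_geometric) auto
  finally show ?thesis
    using B q by (simp add: S_def mult_left_mono mult.commute)
qed

section \<open>From dyadic arcs to Carleson boxes\<close>

text \<open>A deterministic criterion: it suffices to control the masses over dyadic arcs.  A box of size \<open>l\<close>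
only sees points of modulus at least \<open>1 - l\<close>.  For $2^{-m}$ comparable to \<open>l\<close>, its base is
covered by three dyadic arcs of generation \<open>m\<close>.  The finitely many points of modulus below
\<open>1 / 2\<close> are met only by boxes with \<open>l > 1 / 2\<close>, and they are treated apart because several
indices of radius 0 may give the same point.\<close>
lemma carleson_measure_H2_point_mass_sumI:
  fixes \<rho> t :: "nat \<Rightarrow> real"
  defines "z \<equiv> \<lambda>k. complex_of_real (\<rho> k) * cis (t k)"
  assumes \<rho>: "\<And>k. 0 \<le> \<rho> k \<and> \<rho> k < 1"
    and inj: "inj_on z {k. 1 / 2 \<le> \<rho> k}"
    and fin: "finite (dyadic_points (range z) 0)"
    and A: "0 \<le> A"
    and mass: "\<And>m j K. j < 2 ^ m \<Longrightarrow>
      (\<Sum>k\<in>{k. 1 / 2 \<le> \<rho> k \<and> 1 - 1 / 2 ^ m \<le> \<rho> k} \<inter> {..<K}.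
        (1 - \<rho> k) * indicator (dyadic_arc m (int j)) (cis (t k))) \<le> A / 2 ^ m"
  shows "carleson_measure_H2 (point_mass_sum (range z))"
proof -
  define P where "P = dyadic_points (range z) 0"
  define G where "G = {k. 1 / 2 \<le> \<rho> k}"
  define F where "F m = {k. 1 / 2 \<le> \<rho> k \<and> 1 - 1 / 2 ^ m \<le> \<rho> k}" for m :: nat
  have norm_z: "cmod (z k) = \<rho> k" for k
    using \<rho> by (simp add: z_def norm_mult)
  have split: "range z = P \<union> z ` G" "P \<inter> z ` G = {}"
  proof -
    have "z k \<in> P \<longleftrightarrow> \<rho> k < 1 / 2" for k
      using \<rho> by (simp add: P_def dyadic_points_def norm_z)
    moreover have "P \<subseteq> range z" by (auto simp: P_def dyadic_points_def)
    ultimately show "range z = P \<union> z ` G" "P \<inter> z ` G = {}"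
      by (auto simp: G_def)
  qed
  have mass': "(\<Sum>k\<in>F m \<inter> {..<K}. (1 - \<rho> k) * indicator (dyadic_arc m j) (cis (t k))) \<le> A / 2 ^ m"
    for m j K
    using mass[of "nat (j mod 2 ^ m)" m K] by (simp add: F_def dyadic_arc_mod nat_less_iff)
  define C where "C = 2 * real (card P) + 12 * A"
  have "emeasure (point_mass_sum (range z)) (carleson_box I) \<le> ennreal (C * circle_length I)"
    if I: "circle_interval I" for I
  proof (cases "circle_length I = 0")
    case True
    then have "carleson_box I = {}" by (auto simp: carleson_box_def)
    then show ?thesis by simp
  next
    case False
    define l where "l = circle_length I"
    have l: "0 < l" "l \<le> 1"
      using False prob_space.prob_le_1[OF prob_space_circle_measure, of I]
      by (auto simp: l_def zero_less_measure_iff)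
    obtain m where m: "l \<le> 1 / 2 ^ m" "1 / 2 ^ m \<le> 2 * l"
    proof -
      obtain N :: nat where N: "(1 / 2) ^ N < l"
        using real_arch_pow_inv[of l "1 / 2"] l by auto
      define n where "n = (LEAST n. (1 / 2) ^ n < l)"
      have n: "(1 / 2) ^ n < l" unfolding n_def using N by (rule LeastI)
      have "n \<noteq> 0" using n l by (intro notI) simp
      then obtain m where m: "n = Suc m" by (cases n) auto
      have "\<not> (1 / 2) ^ m < l"
        using not_less_Least[of m "\<lambda>n. (1 / 2) ^ n < l"] m by (simp add: n_def)
      then show ?thesis using n by (intro that[of m]) (auto simp: m power_one_over field_simps)
    qed
    obtain j where j: "I \<subseteq> dyadic_arc m (j - 1) \<union> dyadic_arc m j \<union> dyadic_arc m (j + 1)"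
      using arc_subset_three_dyadic_arcs[OF I] m(1) by (auto simp: l_def)
    define f where "f w = ennreal (1 - (cmod w)\<^sup>2) * indicator (carleson_box I) w" for w
    have "emeasure (point_mass_sum (range z)) (carleson_box I) = (\<integral>\<^sup>+ w. f w \<partial>count_space (range z))"
    proof -
      have "range z \<subseteq> ball 0 1" using \<rho> by (auto simp: norm_z)
      then show ?thesis
        using carleson_box_in_sets[OF I] by (simp add: emeasure_point_mass_sum f_def)
    qed
    also have "\<dots> = (\<integral>\<^sup>+ w. f w \<partial>count_space P) + (\<integral>\<^sup>+ w. f w \<partial>count_space (z ` G))"
      using nn_integral_disjoint_pair_countspace[OF split(2), of f]
      unfolding split(1) by (simp add: nn_integral_count_space_indicator)
    also have "(\<integral>\<^sup>+ w. f w \<partial>count_space P) \<le> ennreal (2 * real (card P) * l)"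
    proof -
      have "f w \<le> ennreal (2 * l)" if w: "w \<in> P" for w
      proof (cases "w \<in> carleson_box I")
        case True
        then obtain r s where "w = complex_of_real r * cis s" "1 - l \<le> r" "r < 1"
          by (auto simp: carleson_box_def l_def)
        then have "1 - l \<le> cmod w" using l by (simp add: norm_mult)
        then have "1 \<le> 2 * l" using w by (auto simp: P_def dyadic_points_def)
        then show ?thesis
          using True by (auto simp: f_def intro!: ennreal_leI intro: order_trans[of _ 1])
      qed (simp add: f_def)
      then have "(\<Sum>w\<in>P. f w) \<le> (\<Sum>w\<in>P. ennreal (2 * l))" by (rule sum_mono)
      also have "\<dots> = ennreal (2 * real (card P) * l)"
        using l by (subst sum_ennreal) (auto simp: mult_ac)
      finally show ?thesis
        using fin by (simp add: P_def nn_integral_count_space_finite)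
    qed
    also have "(\<integral>\<^sup>+ w. f w \<partial>count_space (z ` G)) \<le> ennreal (12 * A * l)"
    proof -
      have term_le: "f (z k) * indicator G k \<le> ennreal (if k \<in> F m then 2 *
          ((1 - \<rho> k) * indicator (dyadic_arc m (j - 1)) (cis (t k))
          + (1 - \<rho> k) * indicator (dyadic_arc m j) (cis (t k))
          + (1 - \<rho> k) * indicator (dyadic_arc m (j + 1)) (cis (t k))) else 0)" (is "_ \<le> ennreal (?g k)")
        for k
      proof (cases "k \<in> G \<and> z k \<in> carleson_box I")
        case True
        then obtain r s where r: "z k = complex_of_real r * cis s" "cis s \<in> I" "1 - l \<le> r"
          by (auto simp: carleson_box_def l_def)
        have "r = \<rho> k"
          using arg_cong[OF r(1), of cmod] r(3) l by (simp add: norm_z norm_mult)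
        moreover have "\<rho> k \<noteq> 0" using True by (auto simp: G_def)
        ultimately have "cis (t k) \<in> I" using r by (simp add: z_def)
        then have arcs: "cis (t k) \<in> dyadic_arc m (j - 1) \<union> dyadic_arc m j \<union> dyadic_arc m (j + 1)"
          using j by blast
        have kF: "k \<in> F m" using True r(3) m(1) \<open>r = \<rho> k\<close> by (auto simp: F_def G_def)
        have "1 - (\<rho> k)\<^sup>2 = (1 - \<rho> k) * (1 + \<rho> k)" by (simp add: power2_eq_square algebra_simps)
        also have "\<dots> \<le> (1 - \<rho> k) * 2" using \<rho>[of k] by (intro mult_left_mono) auto
        \<comment> \<open>The three indicators may overlap, but at least one of them equals 1.\<close>
        also have "\<dots> \<le> ?g k" using kF arcs \<rho>[of k] by (auto simp: indicator_def)
        finally have "ennreal (1 - (\<rho> k)\<^sup>2) \<le> ennreal (?g k)" by (rule ennreal_leI)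
        moreover have "f (z k) * indicator G k = ennreal (1 - (\<rho> k)\<^sup>2)"
          using True by (simp add: f_def norm_z)
        ultimately show ?thesis by (simp only:)
      next
        case False
        then show ?thesis by (auto simp: f_def)
      qed
      have "(\<integral>\<^sup>+ w. f w \<partial>count_space (z ` G)) = (\<integral>\<^sup>+ k. f (z k) \<partial>count_space G)"
        using inj by (intro nn_integral_bij_count_space[symmetric]) (simp add: G_def bij_betw_def)
      also have "\<dots> = (\<Sum>k. f (z k) * indicator G k)"
        by (simp add: nn_integral_count_space_indicator nn_integral_count_space_nat)
      also have "\<dots> \<le> ennreal (12 * A * l)"
      proof (rule suminf_le_const)
        fix K
        have "(\<Sum>k<K. f (z k) * indicator G k) \<le> (\<Sum>k<K. ennreal (?g k))"
          by (rule sum_mono) (rule term_le)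
        also have "\<dots> = ennreal (\<Sum>k<K. ?g k)"
          using \<rho> by (intro sum_ennreal) (auto simp: indicator_def less_imp_le)
        also have "\<dots> \<le> ennreal (12 * A * l)"
        proof (rule ennreal_leI)
          have "(\<Sum>k<K. ?g k) = (\<Sum>k\<in>F m \<inter> {..<K}. ?g k)"
            by (intro sum.mono_neutral_right) auto
          also have "\<dots> = 2 * ((\<Sum>k\<in>F m \<inter> {..<K}. (1 - \<rho> k) * indicator (dyadic_arc m (j - 1)) (cis (t k)))
            + (\<Sum>k\<in>F m \<inter> {..<K}. (1 - \<rho> k) * indicator (dyadic_arc m j) (cis (t k)))
            + (\<Sum>k\<in>F m \<inter> {..<K}. (1 - \<rho> k) * indicator (dyadic_arc m (j + 1)) (cis (t k))))"
            unfolding sum.distrib[symmetric] sum_distrib_left by (intro sum.cong) auto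
          also have "\<dots> \<le> 2 * (A / 2 ^ m + A / 2 ^ m + A / 2 ^ m)"
            by (intro mult_left_mono add_mono mass') auto
          also have "\<dots> = 6 * A * (1 / 2 ^ m)" by simp
          also have "\<dots> \<le> 6 * A * (2 * l)" using m(2) A by (intro mult_left_mono) auto
          finally show "(\<Sum>k<K. ?g k) \<le> 12 * A * l" by simp
        qed
        finally show "(\<Sum>k<K. f (z k) * indicator G k) \<le> ennreal (12 * A * l)" .
      qed auto
      finally show ?thesis .
    qed
    also have "ennreal (2 * real (card P) * l) + ennreal (12 * A * l) = ennreal (C * l)"
      using A l by (simp add: C_def distrib_right flip: ennreal_plus)
    finally show ?thesis by (simp add: l_def add_mono)
  qed
  moreover have "C \<ge> 0" using A by (simp add: C_def)
  ultimately show ?thesis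
    by (auto simp: carleson_measure_H2_def point_mass_sum_def)
qed

section \<open>Counting points in dyadic annuli\<close>

lemma inj_on_positive_radius:
  fixes \<rho> t :: "nat \<Rightarrow> real"
  assumes inj: "inj (\<lambda>k. cis (t k))"
  shows "inj_on (\<lambda>k. complex_of_real (\<rho> k) * cis (t k)) {k. 0 < \<rho> k}"
proof (rule inj_onI)
  fix i k
  assume pos: "i \<in> {k. 0 < \<rho> k}" "k \<in> {k. 0 < \<rho> k}"
    and eq: "complex_of_real (\<rho> i) * cis (t i) = complex_of_real (\<rho> k) * cis (t k)"
  have "\<rho> i = \<rho> k" using arg_cong[OF eq, of cmod] pos by (simp add: norm_mult)
  then have "cis (t i) = cis (t k)" using eq pos by simp
  then show "i = k" using inj by (simp add: inj_on_def)
qed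

text \<open>Almost surely the random counts are the deterministic counts of radii: distinct directions give
distinct points, as long as the radius is positive, which it is in every level \<open>n \<ge> 1\<close>.\<close>
lemma bij_betw_level_dyadic_points:
  fixes \<rho> t :: "nat \<Rightarrow> real"
  assumes \<rho>: "\<And>k. 0 \<le> \<rho> k" and inj: "inj (\<lambda>k. cis (t k))" and n: "n \<ge> 1"
  defines "z \<equiv> \<lambda>k. complex_of_real (\<rho> k) * cis (t k)"
  shows "bij_betw z {k. 1 - 1 / 2 ^ n \<le> \<rho> k \<and> \<rho> k < 1 - 1 / 2 ^ (n + 1)} (dyadic_points (range z) n)"
proof (rule bij_betw_imageI)
  have norm_z: "cmod (z k) = \<rho> k" for k
    using \<rho> by (simp add: z_def norm_mult)
  have "2 ^ 1 \<le> (2::real) ^ n" using n by (intro power_increasing) auto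
  then have pos: "0 < 1 - 1 / (2::real) ^ n" by (simp add: field_simps)
  show "inj_on z {k. 1 - 1 / 2 ^ n \<le> \<rho> k \<and> \<rho> k < 1 - 1 / 2 ^ (n + 1)}"
    unfolding z_def
    by (rule inj_on_subset[OF inj_on_positive_radius[OF inj]]) (use pos in \<open>blast intro: less_le_trans\<close>)
  show "z ` {k. 1 - 1 / 2 ^ n \<le> \<rho> k \<and> \<rho> k < 1 - 1 / 2 ^ (n + 1)} = dyadic_points (range z) n"
    by (auto simp: dyadic_points_def norm_z)
qed

section \<open>The Carleson property\<close>

theorem theorem1p1:
  fixes M :: "'a measure"
    and \<rho> :: "nat \<Rightarrow> real"
    and \<theta> :: "nat \<Rightarrow> 'a \<Rightarrow> real"
    and \<beta> :: real
  assumes "prob_space M"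
    and "\<And>n. 0 \<le> \<rho> n \<and> \<rho> n < 1"
    and "prob_space.indep_vars M (\<lambda>_. borel) \<theta> UNIV"
    and "\<And>n. distr M borel (\<theta> n) = uniform_measure lborel {0..2 * pi}"
    and "AE \<omega> in M. \<forall>n. finite (dyadic_points (random_points \<rho> \<theta> \<omega>) n)"
    and "\<beta> > 1"
    and "AE \<omega> in M. (\<lambda>n. 1 / 2 ^ n * real (card (dyadic_points (random_points \<rho> \<theta> \<omega>) n)) powr \<beta>)
           summable_on {1..}"
  shows "AE \<omega> in M. carleson_measure_H2 (point_mass_sum (random_points \<rho> \<theta> \<omega>))"
proof -
  interpret prob_space M by fact
  note \<rho> = assms(2) and indep = assms(3) and unif = assms(4)
  have cis: "cis \<in> borel_measurable borel"
    by (intro borel_measurable_continuous_onI continuous_intros)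
  have \<theta>_meas: "\<theta> k \<in> borel_measurable M" for k
    using indep by (auto simp: indep_vars_def)
  have indep_cis: "indep_vars (\<lambda>_. borel) (\<lambda>k \<omega>. cis (\<theta> k \<omega>)) UNIV"
    by (rule indep_vars_compose2[OF indep]) (rule cis)
  have arc_prob: "prob ((\<lambda>\<omega>. cis (\<theta> k \<omega>)) -` dyadic_arc m (int j) \<inter> space M) \<le> 1 / 2 ^ m"
    if "j < 2 ^ m" for m j k
  proof -
    have "circle_measure = distr M borel (\<lambda>\<omega>. cis (\<theta> k \<omega>))"
      unfolding circle_measure_def unif[of k, symmetric]
      by (subst distr_distr[OF cis \<theta>_meas]) (simp add: comp_def)
    moreover have "measure (distr M borel (\<lambda>\<omega>. cis (\<theta> k \<omega>))) (dyadic_arc m (int j))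
        = prob ((\<lambda>\<omega>. cis (\<theta> k \<omega>)) -` dyadic_arc m (int j) \<inter> space M)"
      by (rule measure_distr[OF measurable_compose[OF \<theta>_meas cis] dyadic_arc_borel])
    ultimately show ?thesis
      using circle_length_dyadic_arc_le[OF that] by simp
  qed
  have inj: "AE \<omega> in M. inj (\<lambda>k. cis (\<theta> k \<omega>))"
    by (rule AE_inj_uniform_circle[OF indep_cis arc_prob])

  define L where "L n = {k. 1 - 1 / 2 ^ n \<le> \<rho> k \<and> \<rho> k < 1 - 1 / 2 ^ (n + 1)}" for n :: nat
  \<comment> \<open>If $N_n$ is at most a constant times $2^{n/\beta}$, the mass of level \<open>n\<close> is at most a constant times $2^{n/\beta - n} = q^n$.\<close>
  define q where "q = 2 powr (1 / \<beta> - 1)"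
  have q: "0 < q" "q < 1" using assms(6) by (auto simp: q_def powr_less_one)
  \<comment> \<open>The counts of radii are deterministic, so a single good outcome \<open>\<omega>\<close> yields their finiteness and growth.\<close>
  obtain B where L: "\<And>n. n \<ge> 1 \<Longrightarrow> finite (L n)"
    "\<And>n. n \<ge> 1 \<Longrightarrow> real (card (L n)) \<le> B * (2 * q) ^ n"
  proof -
    have "AE \<omega> in M. inj (\<lambda>k. cis (\<theta> k \<omega>)) \<and>
        (\<forall>n. finite (dyadic_points (random_points \<rho> \<theta> \<omega>) n)) \<and>
        (\<lambda>n. 1 / 2 ^ n * real (card (dyadic_points (random_points \<rho> \<theta> \<omega>) n)) powr \<beta>) summable_on {1..}"
      using inj assms(5,7) by eventually_elim blast
    then obtain \<omega> where inj_\<omega>: "inj (\<lambda>k. cis (\<theta> k \<omega>))"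
      and fin: "\<And>n. finite (dyadic_points (random_points \<rho> \<theta> \<omega>) n)"
      and sm: "(\<lambda>n. 1 / 2 ^ n * real (card (dyadic_points (random_points \<rho> \<theta> \<omega>) n)) powr \<beta>) summable_on {1..}"
      using eventually_happens'[OF ae_filter_bot] by blast
    have bij: "bij_betw (\<lambda>k. complex_of_real (\<rho> k) * cis (\<theta> k \<omega>)) (L n)
        (dyadic_points (random_points \<rho> \<theta> \<omega>) n)" if "n \<ge> 1" for n
      unfolding L_def random_points_def
      by (rule bij_betw_level_dyadic_points) (use \<rho> inj_\<omega> that in auto)
    define T where "T = (\<Sum>\<^sub>\<infinity>n\<in>{1..}. 1 / 2 ^ n * real (card (dyadic_points (random_points \<rho> \<theta> \<omega>) n)) powr \<beta>)"
    have "real (card (L n)) \<le> T powr (1 / \<beta>) * (2 * q) ^ n" if n: "n \<ge> 1" for n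
    proof -
      have "1 / 2 ^ n * real (card (L n)) powr \<beta> \<le> T"
        unfolding T_def bij_betw_same_card[OF bij[OF n]]
        using finite_sum_le_infsum[OF sm, of "{n}"] n by simp
      then have "real (card (L n)) powr \<beta> \<le> T * 2 ^ n" by (simp add: field_simps)
      then have "(real (card (L n)) powr \<beta>) powr (1 / \<beta>) \<le> (T * 2 ^ n) powr (1 / \<beta>)"
        using assms(6) by (intro powr_mono2) auto
      moreover have "(real (card (L n)) powr \<beta>) powr (1 / \<beta>) = real (card (L n))"
        using assms(6) by (simp add: powr_powr)
      moreover have "0 \<le> T" unfolding T_def by (intro infsum_nonneg) auto
      moreover have "(2 ^ n) powr (1 / \<beta>) = (2 * q) ^ n"
      proof -
        have "2 * q = 2 powr (1 / \<beta>)" by (simp add: q_def powr_diff)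
        then show ?thesis by (simp add: powr_powr mult.commute flip: powr_realpow)
      qed
      ultimately show ?thesis by (simp add: powr_mult)
    qed
    moreover have "finite (L n)" if "n \<ge> 1" for n
      using bij_betw_finite[OF bij[OF that]] fin by blast
    ultimately show ?thesis using that by blast
  qed

  define F where "F m = {k. 1 / 2 \<le> \<rho> k \<and> 1 - 1 / 2 ^ m \<le> \<rho> k}" for m :: nat
  have "AE \<omega> in M. \<exists>A\<ge>0. \<forall>m. \<forall>j<2^m. \<forall>K. (\<Sum>k\<in>F m \<inter> {..<K}.
      (1 - \<rho> k) * indicator (dyadic_arc m (int j)) (cis (\<theta> k \<omega>))) \<le> A / 2 ^ m"
  proof (rule AE_weighted_hits_bounded[OF indep_cis dyadic_arc_borel arc_prob])
    show "0 \<le> 1 - \<rho> k \<and> 1 - \<rho> k \<le> 1 / 2 ^ m" if "k \<in> F m" for m k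
      using that \<rho>[of k] by (auto simp: F_def)
    show "(\<Sum>k\<in>F m \<inter> {..<K}. 1 - \<rho> k) \<le> B / (1 - q) * q ^ m" for m K
      unfolding F_def using \<rho> L q unfolding L_def by (intro tail_mass_geometric) auto
  qed (use q in auto)
  then show ?thesis
    using inj assms(5)
  proof eventually_elim
    case (elim \<omega>)
    then obtain A where A: "0 \<le> A" "\<And>m j K. j < 2 ^ m \<Longrightarrow> (\<Sum>k\<in>F m \<inter> {..<K}.
      (1 - \<rho> k) * indicator (dyadic_arc m (int j)) (cis (\<theta> k \<omega>))) \<le> A / 2 ^ m" by blast
    show ?case
      unfolding random_points_def
    proof (rule carleson_measure_H2_point_mass_sumI[OF \<rho> _ _ A(1)])
      show "finite (dyadic_points (range (\<lambda>k. complex_of_real (\<rho> k) * cis (\<theta> k \<omega>))) 0)"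
        using elim by (simp add: random_points_def)
      show "inj_on (\<lambda>k. complex_of_real (\<rho> k) * cis (\<theta> k \<omega>)) {k. 1 / 2 \<le> \<rho> k}"
        by (rule inj_on_subset[OF inj_on_positive_radius]) (use elim in auto)
    qed (use A(2) in \<open>auto simp: F_def\<close>)
  qed
qed

end
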